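(* Let $R>0$ and $n\ge1$. Let $$S_R=\Big\{(\theta_1,\dots,\theta_n)\in\mathbb R^n:\ \sum_{i=1}^n\theta_i^2=R^2\Big\},\qquad B_{R/2}=\Big\{(x_1,\dots,x_n)\in\mathbb R^n:\ \sum_{i=1}^n x_i^2\le R^2/4\Big\}.$$ Let $\gamma$ be the standard Gaussian measure on $\mathbb R^n$. Then for each Borel set $\Omega\subset\mathbb R^n$, $$\gamma(\overline{\Omega})+\gamma(\Omega+S_R)>1-\gamma(B_{R/2}).$$
   Context: Here $\overline{\Omega}=\mathbb R^n\setminus\Omega$ denotes the complement of $\Omega$ (not the closure), and $\Omega+S_R=\{\omega+\theta:\omega\in\Omega,\ \theta\in S_R\}$ is the Minkowski sum. The standard Gaussian measure $\gamma$ is the law of a random vector with $n$ i.i.d. $N(0,1)$ components. *)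

theory Defs
  imports "HOL-Probability.Probability"
begin

text \<open>
  The standard Gaussian measure on \<open>\<real>\<^sup>n\<close>, as the law of a random vector with i.i.d.
  \<open>N(0,1)\<close> components. It is a measure on the Borel sets.
\<close>

definition std_gaussian :: "(real ^ 'n::finite) measure" where
  "std_gaussian =
     distr (PiM UNIV (\<lambda>_ :: 'n. density lborel std_normal_density)) borel (\<lambda>f. \<chi> i. f i)"

text \<open>The vector map is measurable, so the push-forward above is not a degenerate one.\<close>

lemma measurable_vec_PiM_std_normal:
  "(\<lambda>f. \<chi> i. f i) \<in>
     measurable (PiM UNIV (\<lambda>_ :: 'n::finite. density lborel std_normal_density)) borel"
proof -
  let ?P = "PiM UNIV (\<lambda>_ :: 'n. density lborel std_normal_density)"
  have "(\<lambda>f. (\<chi> i. f i) \<bullet> (b :: real ^ 'n)) \<in> borel_measurable ?P" if "b \<in> Basis" for b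
  proof -
    from that obtain j where b: "b = axis j 1"
      by (auto simp: Basis_vec_def)
    have "(\<lambda>f. f j) \<in> measurable ?P (density lborel std_normal_density)"
      by (rule measurable_component_singleton) simp
    then have "(\<lambda>f. f j) \<in> borel_measurable ?P"
      by simp
    then show ?thesis
      by (simp add: b inner_axis)
  qed
  then show ?thesis
    by (subst borel_measurable_euclidean_space) auto
qed

lemma sets_std_gaussian [simp, measurable_cong]: "sets std_gaussian = sets borel"
  and space_std_gaussian [simp]: "space std_gaussian = UNIV"
  by (simp_all add: std_gaussian_def)

lemma prob_space_std_gaussian: "prob_space (std_gaussian :: (real ^ 'n::finite) measure)"
proof -
  interpret product_prob_space "\<lambda>_ :: 'n. density lborel std_normal_density" UNIV
    by (intro product_prob_spaceI prob_space_normal_density) simp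
  show ?thesis
    unfolding std_gaussian_def by (rule prob_space_distr) (rule measurable_vec_PiM_std_normal)
qed

lemma norm_power2_eq_sum: "(norm (x :: real ^ 'n))\<^sup>2 = (\<Sum>i\<in>UNIV. (x $ i)\<^sup>2)"
  by (simp add: norm_vec_def L2_set_def sum_nonneg)

lemma sphere_0_eq_sum_squares:
  fixes R :: real
  assumes "R > 0"
  shows "sphere 0 R = {\<theta> :: real ^ 'n. (\<Sum>i\<in>UNIV. (\<theta> $ i)\<^sup>2) = R\<^sup>2}"
proof -
  have "norm \<theta> = R \<longleftrightarrow> (norm \<theta>)\<^sup>2 = R\<^sup>2" for \<theta> :: "real ^ 'n"
    using power2_eq_iff_nonneg[of "norm \<theta>" R] assms by simp
  then show ?thesis
    by (simp only: set_eq_iff mem_sphere_0 mem_cball_0 mem_Collect_eq norm_power2_eq_sum simp_thms)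
qed

lemma cball_0_eq_sum_squares:
  fixes R :: real
  assumes "R > 0"
  shows "cball 0 (R / 2) = {x :: real ^ 'n. (\<Sum>i\<in>UNIV. (x $ i)\<^sup>2) \<le> R\<^sup>2 / 4}"
proof -
  have "norm x \<le> R / 2 \<longleftrightarrow> (norm x)\<^sup>2 \<le> R\<^sup>2 / 4" for x :: "real ^ 'n"
    using abs_le_square_iff[of "norm x" "R / 2"] assms by (simp add: power_divide)
  then show ?thesis
    by (simp only: set_eq_iff mem_sphere_0 mem_cball_0 mem_Collect_eq norm_power2_eq_sum simp_thms)
qed

end

theory Submission
  imports Defs "HOL-Real_Asymp.Real_Asymp"
begin

text \<open>
  The probabilistic reason is a reflection coupling. Run a Brownian motion \<open>X\<close> from the origin and
  let \<open>Y = - X\<close> until \<open>|X|\<close> first reaches \<open>R / 2\<close>; from then on keep \<open>Y - X\<close> constant, a vector of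
  length \<open>R\<close>. Both \<open>X\<close> and \<open>Y\<close> are standard Gaussian at time 1, and \<open>|X - Y| = R\<close> unless \<open>|X|\<close> has
  stayed below \<open>R / 2\<close>. Hence \<open>X \<in> \<Omega>\<close> forces \<open>Y \<in> \<Omega> + S\<^sub>R\<close> outside of an event which is strictly less
  likely than \<open>|X| \<le> R / 2\<close> at time 1, and this is the claim.

  The proof below is the analytic form of this argument, in which the stopping time becomes a
  maximum principle. Let \<open>f\<close>, \<open>g\<close> and \<open>b\<close> be continuous approximations, from above, of the indicators
  of a compact \<open>K\<close>, of \<open>K + S\<^sub>R\<close> and of the ball \<open>B\<close> of radius \<open>R / 2\<close>, with \<open>f x \<le> g y\<close> whenever
  \<open>|x - y| = R\<close>. The heat flow \<open>u\<close> of \<open>f - g \<circ> uminus - b + c * (1 - b)\<close> is nonpositive on \<open>B\<close> at time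
  0, since there \<open>b = 1\<close> and \<open>f \<le> 1\<close>. It is nonpositive on the boundary of \<open>B\<close> at all times up to 1:
  the points \<open>x\<close> and \<open>- x\<close> are then at distance \<open>R\<close> and keep it when the same noise is added to
  both, so the flow of \<open>f\<close> at \<open>x\<close> is at most that of \<open>g\<close> at \<open>- x\<close>, and the flow of \<open>b\<close> has there a
  positive lower bound, which is chosen as \<open>c\<close>. The maximum principle
  (\<open>heat_maximum_principle\<close>) gives \<open>u \<le> 0\<close> at time 1 and at the origin. Sharpening the
  approximations turns this into
  \<open>\<gamma>(K) + c * (1 - \<gamma>(B)) \<le> \<gamma>(K + S\<^sub>R) + \<gamma>(B)\<close> (\<open>gaussian_compact_inequality\<close>). The term with \<open>c\<close> is
  positive and does not depend on \<open>K\<close>, so it survives the inner approximation of \<open>\<Omega>\<close> by compact sets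
  and makes the final inequality strict.

  The remaining point is that \<open>\<Omega> + S\<^sub>R\<close> is measurable for the completion, so that its measure does
  dominate that of \<open>K + S\<^sub>R\<close>. The sum is an analytic set, and analytic sets are measurable for the
  completion of every finite Borel measure (\<open>analytic_set_in_completion\<close>).
\<close>

section \<open>Measurability of analytic sets\<close>

text \<open>
  Projections of closed subsets \<open>C\<close> of \<open>\<nat>\<^sup>\<nat> \<times> X\<close>. If \<open>(s, x) \<in> C\<close>, the sequence \<open>s\<close> is called a code for
  the point \<open>x\<close>. In this form, countable unions and intersections only require continuous recodings.
\<close>
definition analytic_set :: "'a::topological_space set \<Rightarrow> bool" where
  "analytic_set A \<longleftrightarrow> (\<exists>C :: ((nat \<Rightarrow> nat) \<times> 'a) set. closed C \<and> A = snd ` C)"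

lemma analytic_set_closed:
  assumes "closed A"
  shows "analytic_set A"
proof -
  have "closed ((UNIV :: (nat \<Rightarrow> nat) set) \<times> A)"
    using assms by (intro closed_Times) auto
  then show ?thesis
    unfolding analytic_set_def by (intro exI[of _ "UNIV \<times> A"]) auto
qed

lemma closed_nat_set: "closed (A :: nat set)"
  unfolding closed_def by (rule discrete_topology_class.open_discrete)

lemma continuous_on_fst_coordinate:
  "continuous_on UNIV (\<lambda>p :: ('i \<Rightarrow> 'b::topological_space) \<times> 'a::topological_space. fst p i)"
  by (rule continuous_on_product_then_coordinatewise) (rule continuous_on_fst[OF continuous_on_id])

text \<open>
  The first entry of the code says in which set of the family the point lies; the remaining entries
  are the code for that set.
\<close>
lemma analytic_set_UN:
  fixes A :: "nat \<Rightarrow> 'a::topological_space set"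
  assumes "\<And>m. analytic_set (A m)"
  shows "analytic_set (\<Union>m. A m)"
proof -
  have "\<forall>m. \<exists>C :: ((nat \<Rightarrow> nat) \<times> 'a) set. closed C \<and> A m = snd ` C"
    using assms unfolding analytic_set_def by blast
  from choice[OF this] obtain C
    where C0: "\<forall>m. closed (C m :: ((nat \<Rightarrow> nat) \<times> 'a) set) \<and> A m = snd ` C m" ..
  have C: "closed (C m)" "A m = snd ` C m" for m
    using conjunct1[OF spec[OF C0, of m]] conjunct2[OF spec[OF C0, of m]] .
  have mem: "x \<in> A m \<longleftrightarrow> (\<exists>s. (s, x) \<in> C m)" for x m
    unfolding C(2) by force
  define D :: "((nat \<Rightarrow> nat) \<times> 'a) set" where
    "D = (\<Inter>m. {p. fst p 0 \<noteq> m} \<union> {p. (\<lambda>k. fst p (Suc k), snd p) \<in> C m})"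
  have "closed D"
    unfolding D_def
  proof (intro closed_INT ballI closed_Un)
    fix m
    have "closed ((\<lambda>p :: (nat \<Rightarrow> nat) \<times> 'a. fst p 0) -` (- {m}))"
      by (rule closed_vimage[OF closed_nat_set continuous_on_fst_coordinate])
    then show "closed {p :: (nat \<Rightarrow> nat) \<times> 'a. fst p 0 \<noteq> m}"
      by (simp add: vimage_def)
    have "continuous_on UNIV (\<lambda>p :: (nat \<Rightarrow> nat) \<times> 'a. (\<lambda>k. fst p (Suc k), snd p))"
      by (intro continuous_on_Pair continuous_on_coordinatewise_then_product
            continuous_on_fst_coordinate continuous_on_snd continuous_on_id)
    from closed_vimage[OF C(1) this]
    show "closed {p. (\<lambda>k. fst p (Suc k), snd p) \<in> C m}"
      by (simp add: vimage_def)
  qed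
  moreover have "(\<Union>m. A m) = snd ` D"
  proof safe
    fix m x assume "x \<in> A m"
    then obtain s where s: "(s, x) \<in> C m"
      unfolding mem by auto
    have "((\<lambda>k. case k of 0 \<Rightarrow> m | Suc k \<Rightarrow> s k), x) \<in> D"
      using s by (auto simp: D_def)
    then show "x \<in> snd ` D"
      by force
  next
    fix s x assume "(s, x) \<in> D"
    then show "snd (s, x) \<in> (\<Union>m. A m)"
      by (auto simp: mem D_def)
  qed
  ultimately show ?thesis
    unfolding analytic_set_def by blast
qed

text \<open>
  One sequence codes countably many sequences through the pairing function, so a single code can
  witness membership in all sets of the family at once.
\<close>
lemma analytic_set_INT:
  fixes A :: "nat \<Rightarrow> 'a::topological_space set"
  assumes "\<And>m. analytic_set (A m)"
  shows "analytic_set (\<Inter>m. A m)"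
proof -
  have "\<forall>m. \<exists>C :: ((nat \<Rightarrow> nat) \<times> 'a) set. closed C \<and> A m = snd ` C"
    using assms unfolding analytic_set_def by blast
  from choice[OF this] obtain C
    where C0: "\<forall>m. closed (C m :: ((nat \<Rightarrow> nat) \<times> 'a) set) \<and> A m = snd ` C m" ..
  have C: "closed (C m)" "A m = snd ` C m" for m
    using conjunct1[OF spec[OF C0, of m]] conjunct2[OF spec[OF C0, of m]] .
  have mem: "x \<in> A m \<longleftrightarrow> (\<exists>s. (s, x) \<in> C m)" for x m
    unfolding C(2) by force
  define D :: "((nat \<Rightarrow> nat) \<times> 'a) set" where
    "D = (\<Inter>m. {p. (\<lambda>k. fst p (prod_encode (m, k)), snd p) \<in> C m})"
  have "closed D"
    unfolding D_def
  proof (intro closed_INT ballI)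
    fix m
    have "continuous_on UNIV (\<lambda>p :: (nat \<Rightarrow> nat) \<times> 'a. (\<lambda>k. fst p (prod_encode (m, k)), snd p))"
      by (intro continuous_on_Pair continuous_on_coordinatewise_then_product
            continuous_on_fst_coordinate continuous_on_snd continuous_on_id)
    from closed_vimage[OF C(1) this]
    show "closed {p. (\<lambda>k. fst p (prod_encode (m, k)), snd p) \<in> C m}"
      by (simp add: vimage_def)
  qed
  moreover have "(\<Inter>m. A m) = snd ` D"
  proof (intro equalityI subsetI)
    fix x assume "x \<in> (\<Inter>m. A m)"
    then have "\<forall>m. \<exists>s. (s, x) \<in> C m"
      unfolding INT_iff mem by blast
    from choice[OF this] obtain s where s: "\<And>m. (s m, x) \<in> C m"
      by blast
    have "((\<lambda>j. case prod_decode j of (m, k) \<Rightarrow> s m k), x) \<in> D"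
      using s by (auto simp: D_def)
    then show "x \<in> snd ` D"
      by force
  next
    fix x assume "x \<in> snd ` D"
    then show "x \<in> (\<Inter>m. A m)"
      by (auto simp: mem D_def)
  qed
  ultimately show ?thesis
    unfolding analytic_set_def by blast
qed

lemma analytic_set_open:
  fixes A :: "'a::metric_space set"
  assumes "open A"
  shows "analytic_set A"
proof (cases "A = UNIV")
  case True
  then show ?thesis by (simp add: analytic_set_closed)
next
  case False
  have eq: "A = (\<Union>n. {x. 1 / real (Suc n) \<le> infdist x (- A)})"
  proof (intro equalityI subsetI)
    fix x assume "x \<in> A"
    then have "infdist x (- A) > 0"
      using assms False in_closed_iff_infdist_zero[of "- A" x] infdist_nonneg[of x "- A"]
      by (auto simp: closed_Compl less_le)
    then obtain n where "1 / real (Suc n) < infdist x (- A)"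
      by (metis nat_approx_posE)
    then show "x \<in> (\<Union>n. {x. 1 / real (Suc n) \<le> infdist x (- A)})"
      by (auto intro: less_imp_le)
  next
    fix x assume "x \<in> (\<Union>n. {x. 1 / real (Suc n) \<le> infdist x (- A)})"
    then obtain n where "1 / real (Suc n) \<le> infdist x (- A)" by auto
    moreover have "1 / real (Suc n) > 0" by simp
    ultimately have "infdist x (- A) \<noteq> 0" by linarith
    then show "x \<in> A" by (metis ComplI infdist_zero)
  qed
  have "analytic_set (\<Union>n. {x. 1 / real (Suc n) \<le> infdist x (- A)})"
    by (intro analytic_set_UN analytic_set_closed closed_Collect_le continuous_intros)
  then show ?thesis
    by (subst eq)
qed

text \<open>
  Complements of analytic sets need not be analytic, but the sets that are analytic together with their
  complement form a \<open>\<sigma>\<close>-algebra, and it contains the open sets because these are countable unions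
  of closed sets.
\<close>
lemma analytic_set_borel:
  fixes A :: "'a::metric_space set"
  assumes "A \<in> sets borel"
  shows "analytic_set A"
proof -
  have "A \<in> sigma_sets UNIV {S. open S}"
    using assms by (simp add: borel_def)
  then have "analytic_set A \<and> analytic_set (- A)"
  proof induction
    case (Basic a)
    then show ?case by (auto intro: analytic_set_open analytic_set_closed)
  next
    case Empty
    then show ?case by (simp add: analytic_set_closed)
  next
    case (Compl a)
    then show ?case by (simp add: Compl_eq_Diff_UNIV[symmetric])
  next
    case (Union a)
    then show ?case
      by (simp add: analytic_set_UN analytic_set_INT uminus_SUP)
  qed
  then show ?thesis ..
qed

text \<open>
  The summand from \<open>S\<close> can be eliminated without becoming part of the code, since the projection
  along a compact factor is a closed map.
\<close>
lemma analytic_set_compact_sum: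
  fixes A S :: "'a::real_normed_vector set"
  assumes "analytic_set A" "compact S"
  shows "analytic_set {a + s |a s. a \<in> A \<and> s \<in> S}"
proof -
  obtain C where C: "closed (C :: ((nat \<Rightarrow> nat) \<times> 'a) set)" "A = snd ` C"
    using assms(1) unfolding analytic_set_def by blast
  define U where "U = S \<times> UNIV \<inter> {q :: 'a \<times> (nat \<Rightarrow> nat) \<times> 'a. (fst (snd q), snd (snd q) - fst q) \<in> C}"
  have "continuous_on UNIV (\<lambda>q :: 'a \<times> (nat \<Rightarrow> nat) \<times> 'a. (fst (snd q), snd (snd q) - fst q))"
    by (intro continuous_intros)
  from closed_vimage[OF C(1) this]
  have "closedin (top_of_set (S \<times> UNIV)) U"
    unfolding U_def closedin_closed by (auto simp: vimage_def)
  moreover have "closed_map (top_of_set (S \<times> UNIV)) (euclidean :: ((nat \<Rightarrow> nat) \<times> 'a) topology) snd"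
    using closed_map_snd[of "top_of_set S" "euclidean :: ((nat \<Rightarrow> nat) \<times> 'a) topology"] assms(2)
    by (simp add: compact_space_subtopology prod_topology_subtopology)
  ultimately have "closedin euclidean (snd ` U)"
    unfolding closed_map_def by blast
  then have "closed (snd ` U)" by simp
  moreover have "{a + s |a s. a \<in> A \<and> s \<in> S} = snd ` (snd ` U)"
  proof (intro equalityI subsetI)
    fix y assume "y \<in> {a + s |a s. a \<in> A \<and> s \<in> S}"
    then obtain f a s where "(f, a) \<in> C" "s \<in> S" "y = a + s"
      using C(2) by force
    then have "(s, (f, y)) \<in> U" by (simp add: U_def)
    then show "y \<in> snd ` (snd ` U)" by force
  next
    fix y assume "y \<in> snd ` (snd ` U)"
    then obtain s f where "s \<in> S" "(f, y - s) \<in> C" by (auto simp: U_def)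
    moreover from this have "y - s \<in> A" using C(2) by force
    ultimately show "y \<in> {a + s |a s. a \<in> A \<and> s \<in> S}"
      by (intro CollectI exI[of _ "y - s"] exI[of _ s]) simp
  qed
  ultimately show ?thesis unfolding analytic_set_def by blast
qed

text \<open>
  The bound on coordinate \<open>i\<close> holds only for the sequences with index above \<open>i\<close>. Truncating all
  coordinates moves the sequences into a compact product and changes each coordinate for only
  finitely many of them, so it does not affect coordinatewise limits.
\<close>
lemma convergent_subseq_eventually_bounded:
  fixes f :: "nat \<Rightarrow> nat \<Rightarrow> nat" and k :: "nat \<Rightarrow> nat"
  assumes "\<And>m i. i < m \<Longrightarrow> f m i \<le> k i"
  obtains l r where "strict_mono r" "(f \<circ> r) \<longlonglongrightarrow> l"
proof -
  have "compactin (product_topology (\<lambda>i. euclidean) UNIV) (PiE UNIV (\<lambda>i. {..k i}))"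
    by (simp add: compactin_PiE finite_imp_compact)
  then have "compact (PiE UNIV (\<lambda>i. {..k i}))"
    by (simp add: euclidean_product_topology)
  then have "seq_compact (PiE UNIV (\<lambda>i. {..k i}))"
    by (rule compact_imp_seq_compact)
  then have "\<exists>l\<in>PiE UNIV (\<lambda>i. {..k i}). \<exists>r. strict_mono r \<and> ((\<lambda>m i. min (f m i) (k i)) \<circ> r) \<longlonglongrightarrow> l"
    unfolding seq_compact_def by (elim allE[of _ "\<lambda>m i. min (f m i) (k i)"]) auto
  then obtain l r where lr: "strict_mono r" "((\<lambda>m i. min (f m i) (k i)) \<circ> r) \<longlonglongrightarrow> l"
    by blast
  have "(\<lambda>j. (f \<circ> r) j i) \<longlonglongrightarrow> l i" for i
  proof -
    have "(\<lambda>j. ((\<lambda>m i. min (f m i) (k i)) \<circ> r) j i) \<longlonglongrightarrow> l i"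
      using lr(2) limitin_componentwise[of "\<lambda>i. euclidean :: nat topology" UNIV
        "(\<lambda>m i. min (f m i) (k i)) \<circ> r" l sequentially]
      by (simp add: euclidean_product_topology del: o_apply)
    moreover have "\<forall>\<^sub>F j in sequentially. ((\<lambda>m i. min (f m i) (k i)) \<circ> r) j i = (f \<circ> r) j i"
    proof (intro eventually_sequentiallyI)
      fix j assume "Suc i \<le> j"
      with seq_suble[OF lr(1), of j] have "i < r j" by linarith
      with assms show "((\<lambda>m i. min (f m i) (k i)) \<circ> r) j i = (f \<circ> r) j i" by simp
    qed
    ultimately show ?thesis by (rule Lim_transform_eventually)
  qed
  then have "(f \<circ> r) \<longlonglongrightarrow> l"
    using limitin_componentwise[of "\<lambda>i. euclidean :: nat topology" UNIV "f \<circ> r" l sequentially]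
    by (simp add: euclidean_product_topology)
  with lr(1) show ?thesis by (rule that)
qed

text \<open>
  This is Choquet's capacitability argument. Outer measure is continuous along increasing unions, so
  the entries of the code can be bounded one after the other, the \<open>i\<close>-th one by \<open>k i\<close>, without the
  outer measure dropping to \<open>a\<close>. Let \<open>E m\<close> be the part of \<open>A\<close> that has codes obeying the first \<open>m\<close>
  bounds. The closures of the \<open>E m\<close> decrease to a closed set, which has measure at least \<open>a\<close> by
  continuity from above. It lies inside \<open>A\<close>: a point in all the closures is a limit of points with
  more and more bounded codes, and a convergent subsequence of these codes gives a code for it.
\<close>
lemma analytic_inner_approx:
  fixes A :: "'a::metric_space set"
  assumes sets: "sets M = sets borel" and fin: "finite_measure M"
    and A: "analytic_set A" and a: "a < outer_measure_of M A"
  obtains K where "closed K" "K \<subseteq> A" "a \<le> emeasure M K"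
proof -
  interpret finite_measure M by fact
  have space: "space M = UNIV" using sets_eq_imp_space_eq[OF sets] by simp
  obtain C where C: "closed (C :: ((nat \<Rightarrow> nat) \<times> 'a) set)" "A = snd ` C"
    using A unfolding analytic_set_def by blast
  define D where "D ks = snd ` {p \<in> C. \<forall>i<length ks. fst p i \<le> ks ! i}" for ks :: "nat list"
  \<comment> \<open>The points with a code whose first entries are bounded by the list \<open>ks\<close> increase, with the last
    bound, to those of the shorter list.\<close>
  have step: "\<exists>k. a < outer_measure_of M (D (ks @ [k]))" if "a < outer_measure_of M (D ks)" for ks
  proof -
    have "incseq (\<lambda>k. D (ks @ [k]))"
    proof (intro incseq_SucI subsetI)
      fix k x assume "x \<in> D (ks @ [k])"
      then obtain s where "(s, x) \<in> C" "\<forall>i<length (ks @ [k]). s i \<le> (ks @ [k]) ! i"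
        unfolding D_def by auto
      then have "(s, x) \<in> {p \<in> C. \<forall>i<length (ks @ [Suc k]). fst p i \<le> (ks @ [Suc k]) ! i}"
        by (auto simp: nth_append le_Suc_eq split: if_splits)
      from imageI[OF this, of snd] show "x \<in> D (ks @ [Suc k])"
        unfolding D_def by (simp only: snd_conv)
    qed
    moreover have "(\<Union>k. D (ks @ [k])) = D ks"
    proof (intro equalityI subsetI)
      fix x assume "x \<in> (\<Union>k. D (ks @ [k]))"
      then show "x \<in> D ks"
        unfolding D_def by (fastforce simp: nth_append split: if_splits)
    next
      fix x assume "x \<in> D ks"
      then obtain s where s: "(s, x) \<in> C" "\<forall>i<length ks. s i \<le> ks ! i"
        unfolding D_def by auto
      then have "(s, x) \<in> {p \<in> C. \<forall>i<length (ks @ [s (length ks)]). fst p i \<le> (ks @ [s (length ks)]) ! i}"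
        by (auto simp: nth_append less_Suc_eq)
      from imageI[OF this, of snd] have "x \<in> D (ks @ [s (length ks)])"
        unfolding D_def by (simp only: snd_conv)
      then show "x \<in> (\<Union>k. D (ks @ [k]))" by blast
    qed
    ultimately have "(SUP k. outer_measure_of M (D (ks @ [k]))) = outer_measure_of M (D ks)"
      using SUP_outer_measure_of_incseq[of "\<lambda>k. D (ks @ [k])" M] space by simp
    with that have "a < (SUP k. outer_measure_of M (D (ks @ [k])))" by simp
    then show ?thesis unfolding less_SUP_iff by blast
  qed
  have D0: "a < outer_measure_of M (D [])"
    using a C(2) by (simp add: D_def)
  have "\<exists>ks. \<forall>m. (a < outer_measure_of M (D (ks m)) \<and> length (ks m) = m) \<and> (\<exists>k. ks (Suc m) = ks m @ [k])"
  proof (rule dependent_nat_choice)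
    show "\<exists>x. a < outer_measure_of M (D x) \<and> length x = 0"
      using D0 by auto
    show "\<exists>y. (a < outer_measure_of M (D y) \<and> length y = Suc n) \<and> (\<exists>k. y = x @ [k])"
      if x: "a < outer_measure_of M (D x) \<and> length x = n" for x n
    proof -
      obtain k where "a < outer_measure_of M (D (x @ [k]))" using step x by blast
      with x show ?thesis by (intro exI[of _ "x @ [k]"]) auto
    qed
  qed
  then obtain ks where "\<forall>m. (a < outer_measure_of M (D (ks m)) \<and> length (ks m) = m)
      \<and> (\<exists>k. ks (Suc m) = ks m @ [k])" ..
  then have ks: "\<And>m. a < outer_measure_of M (D (ks m))" "\<And>m. length (ks m) = m"
      "\<And>m. \<exists>k. ks (Suc m) = ks m @ [k]"
    by simp_all
  define k where "k i = ks (Suc i) ! i" for i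
  have nth: "ks m ! i = k i" if "i < m" for m i
    using that
  proof (induction m)
    case (Suc m)
    obtain j where "ks (Suc m) = ks m @ [j]" using ks(3) by blast
    with Suc show ?case by (cases "i = m") (auto simp: k_def nth_append ks(2))
  qed simp
  define E where "E m = D (ks m)" for m
  have E: "E m = snd ` {p \<in> C. \<forall>i<m. fst p i \<le> k i}" for m
    unfolding E_def D_def ks(2) using nth by (intro arg_cong[of _ _ "image snd"]) auto
  define K where "K = (\<Inter>m. closure (E m))"
  show ?thesis
  proof
    show "closed K" unfolding K_def by auto
    show "K \<subseteq> A"
    proof
      fix x assume "x \<in> K"
      have "\<exists>p\<in>C. (\<forall>i<m. fst p i \<le> k i) \<and> dist (snd p) x < 1 / real (Suc m)" for m
      proof -
        have "x \<in> closure (E m)" using \<open>x \<in> K\<close> by (simp add: K_def)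
        then obtain y where "y \<in> E m" "dist y x < 1 / real (Suc m)"
          unfolding closure_approachable by (meson of_nat_0_less_iff zero_less_Suc zero_less_divide_1_iff)
        then show ?thesis unfolding E by auto
      qed
      then obtain p where p: "\<And>m. p m \<in> C" "\<And>m i. i < m \<Longrightarrow> fst (p m) i \<le> k i"
          "\<And>m. dist (snd (p m)) x < 1 / real (Suc m)"
        by metis
      obtain l r where lr: "strict_mono r" "((\<lambda>m. fst (p m)) \<circ> r) \<longlonglongrightarrow> l"
        using convergent_subseq_eventually_bounded[of "\<lambda>m. fst (p m)" k, OF p(2)] by blast
      have "(\<lambda>m. snd (p m)) \<longlonglongrightarrow> x"
      proof (rule metric_tendsto_imp_tendsto)
        show "(\<lambda>m. 1 / real (Suc m)) \<longlonglongrightarrow> 0"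
          by (rule LIMSEQ_Suc[OF lim_1_over_n])
        show "\<forall>\<^sub>F m in sequentially. dist (snd (p m)) x \<le> dist (1 / real (Suc m)) 0"
          using p(3) by (auto intro!: always_eventually less_imp_le)
      qed
      then have "((\<lambda>m. snd (p m)) \<circ> r) \<longlonglongrightarrow> x"
        using lr(1) by (rule LIMSEQ_subseq_LIMSEQ)
      then have "(\<lambda>j. (fst (p (r j)), snd (p (r j)))) \<longlonglongrightarrow> (l, x)"
        using lr(2) by (intro tendsto_Pair) (auto simp: o_def)
      then have "(l, x) \<in> C"
        using p(1) C(1) by (intro Lim_in_closed_set[of C "\<lambda>j. p (r j)" sequentially]) auto
      then show "x \<in> A" using C(2) by force
    qed
    have "decseq (\<lambda>m. closure (E m))"
      unfolding E by (intro decseq_SucI closure_mono) auto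
    then have "(INF m. emeasure M (closure (E m))) = emeasure M K"
      unfolding K_def by (intro INF_emeasure_decseq) (auto simp: sets)
    moreover have "a \<le> emeasure M (closure (E m))" for m
    proof -
      have "a \<le> outer_measure_of M (E m)" using ks(1) by (simp add: E_def less_imp_le)
      also have "\<dots> \<le> outer_measure_of M (closure (E m))"
        by (intro outer_measure_of_mono closure_subset)
      also have "\<dots> = emeasure M (closure (E m))"
        by (intro outer_measure_of_eq) (simp add: sets)
      finally show ?thesis .
    qed
    ultimately show "a \<le> emeasure M K"
      using INF_greatest[of UNIV a "\<lambda>m. emeasure M (closure (E m))"] by simp
  qed
qed

text \<open>
  Closed sets from inside and a measurable hull from outside have the same measure, so the analytic
  set differs from a Borel set by a null set.
\<close>
theorem analytic_set_in_completion:
  fixes A :: "'a::metric_space set"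
  assumes sets: "sets M = sets borel" and fin: "finite_measure M" and A: "analytic_set A"
  shows "A \<in> sets (completion M)"
proof -
  interpret finite_measure M by fact
  have space: "space M = UNIV" using sets_eq_imp_space_eq[OF sets] by simp
  obtain E where E: "E \<in> sets M" "A \<subseteq> E" "outer_measure_of M A = emeasure M E"
    using outer_measure_of_attain[of A M] space by auto
  have E_real: "emeasure M E = ennreal (measure M E)"
    by (rule emeasure_eq_measure)
  have "\<exists>K. closed K \<and> K \<subseteq> A \<and> measure M E - 1 / real (Suc n) \<le> measure M K" for n
  proof (cases "measure M E = 0")
    case True
    then show ?thesis by (intro exI[of _ "{}"]) auto
  next
    case False
    then have "measure M E > 0" by (simp add: zero_less_measure_iff)
    then have "ennreal (measure M E - 1 / real (Suc n)) < outer_measure_of M A"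
      unfolding E(3) E_real by (intro ennreal_lessI) auto
    from analytic_inner_approx[OF sets fin A this] obtain K
      where "closed K" "K \<subseteq> A" "ennreal (measure M E - 1 / real (Suc n)) \<le> emeasure M K"
      by metis
    then show ?thesis by (auto simp: emeasure_eq_measure)
  qed
  then obtain K where K: "\<And>n. closed (K n)" "\<And>n. K n \<subseteq> A"
      "\<And>n. measure M E - 1 / real (Suc n) \<le> measure M (K n)"
    by metis
  have K_sets [measurable]: "K n \<in> sets M" for n
    using K(1) by (simp add: sets)
  have le: "measure M E - 1 / real (Suc n) \<le> measure M (\<Union>n. K n)" for n
    using K(3)[of n] by (rule order_trans) (intro finite_measure_mono; auto)
  have "(\<lambda>n. measure M E - 1 / real (Suc n)) \<longlonglongrightarrow> measure M E - 0"
    by (intro tendsto_intros LIMSEQ_Suc[OF lim_1_over_n])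
  then have "measure M E \<le> measure M (\<Union>n. K n)"
    using le by (intro LIMSEQ_le_const2[of _ "measure M E"]) auto
  moreover have "measure M (\<Union>n. K n) \<le> measure M E"
    using K(2) E by (intro finite_measure_mono) auto
  ultimately have eq: "emeasure M (\<Union>n. K n) = emeasure M E"
    by (simp add: emeasure_eq_measure)
  have "(\<Union>n. K n) \<in> sets M" by measurable
  show ?thesis
  proof (rule completion.complete_sets_sandwich)
    show "(\<Union>n. K n) \<in> sets (completion M)" "E \<in> sets (completion M)"
      using \<open>(\<Union>n. K n) \<in> sets M\<close> E(1) by (blast intro: sets_completionI_sets)+
    show "(\<Union>n. K n) \<subseteq> A" "A \<subseteq> E"
      using K(2) E(2) by blast+
    have completion_eq: "emeasure (completion M) S = emeasure M S" if "S \<in> sets M" for S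
      using that by (simp add: emeasure_completion)
    show "emeasure (completion M) (\<Union>n. K n) = emeasure (completion M) E"
      unfolding completion_eq[OF \<open>(\<Union>n. K n) \<in> sets M\<close>] completion_eq[OF E(1)] by (rule eq)
    show "emeasure (completion M) (\<Union>n. K n) < \<infinity>"
      unfolding completion_eq[OF \<open>(\<Union>n. K n) \<in> sets M\<close>] emeasure_eq_measure by simp
  qed
qed

section \<open>Density and convolution of the Gaussian measure\<close>

lemma measurable_vec_PiM_lborel:
  "(\<lambda>f. \<chi> i. f i) \<in> measurable (PiM UNIV (\<lambda>_ :: 'n::finite. lborel)) (borel :: (real ^ 'n) measure)"
proof -
  have "sets (PiM UNIV (\<lambda>_ :: 'n. lborel)) = sets (PiM UNIV (\<lambda>_ :: 'n. density lborel std_normal_density))"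
    by (intro sets_PiM_cong) auto
  from measurable_cong_sets[OF this refl] show ?thesis
    using measurable_vec_PiM_std_normal by blast
qed

text \<open>
  Lebesgue measure is built from a product over the basis vectors, whereas the Gaussian measure comes
  from a product over the index type; both agree on boxes.
\<close>
lemma lborel_vec_eq_distr_PiM:
  "(lborel :: (real ^ 'n::finite) measure) = distr (PiM UNIV (\<lambda>_ :: 'n. lborel)) borel (\<lambda>f. \<chi> i. f i)"
proof (rule lborel_eqI)
  fix l u :: "real ^ 'n"
  assume le: "\<And>b. b \<in> Basis \<Longrightarrow> l \<bullet> b \<le> u \<bullet> b"
  have le': "l $ i \<le> u $ i" for i
    using le[of "axis i 1"] by (simp add: inner_axis axis_in_Basis_iff)
  interpret product_sigma_finite "\<lambda>_ :: 'n. lborel :: real measure"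
    by standard
  have "(\<lambda>f. \<chi> i. f i) -` box l u \<inter> space (PiM UNIV (\<lambda>_ :: 'n. lborel)) = PiE UNIV (\<lambda>i. {l $ i<..<u $ i})"
    by (auto simp: mem_box_cart space_PiM PiE_iff)
  then have "emeasure (distr (PiM UNIV (\<lambda>_ :: 'n. lborel)) borel (\<lambda>f. \<chi> i. f i)) (box l u)
      = emeasure (PiM UNIV (\<lambda>_ :: 'n. lborel)) (PiE UNIV (\<lambda>i. {l $ i<..<u $ i}))"
    by (simp add: emeasure_distr[OF measurable_vec_PiM_lborel])
  also have "\<dots> = (\<Prod>i\<in>UNIV. ennreal (u $ i - l $ i))"
    by (subst emeasure_PiM) (auto simp: le')
  also have "\<dots> = ennreal (\<Prod>i\<in>UNIV. u $ i - l $ i)"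
    by (rule prod_ennreal) (simp add: le')
  also have "(\<Prod>i\<in>UNIV. u $ i - l $ i) = (\<Prod>b\<in>Basis. (u - l) \<bullet> b)"
  proof -
    have Basis: "(Basis :: (real ^ 'n) set) = range (\<lambda>i. axis i 1)"
      by (auto simp: Basis_vec_def)
    have inj: "inj (\<lambda>i :: 'n. axis i (1 :: real))"
      by (auto simp: inj_on_def axis_eq_axis)
    show ?thesis
      unfolding Basis prod.reindex[OF inj] by (simp add: inner_axis)
  qed
  finally show "emeasure (distr (PiM UNIV (\<lambda>_ :: 'n. lborel)) borel (\<lambda>f. \<chi> i. f i)) (box l u)
      = ennreal (\<Prod>b\<in>Basis. (u - l) \<bullet> b)" .
qed simp

definition gauss_density :: "real ^ 'n::finite \<Rightarrow> real" where
  "gauss_density x = (1 / sqrt (2 * pi)) ^ CARD('n) * exp (- (norm x)\<^sup>2 / 2)"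

lemma gauss_density_pos: "gauss_density x > 0"
  by (simp add: gauss_density_def)

lemma measurable_gauss_density [measurable]: "gauss_density \<in> borel_measurable borel"
  unfolding gauss_density_def[abs_def] by measurable

lemma gauss_density_eq_prod:
  "gauss_density (x :: real ^ 'n::finite) = (\<Prod>i\<in>UNIV. std_normal_density (x $ i))"
  by (simp add: gauss_density_def std_normal_density_def prod.distrib exp_sum[symmetric]
      norm_power2_eq_sum sum_divide_distrib sum_negf power_divide prod_dividef)

lemma std_gaussian_eq_density:
  "(std_gaussian :: (real ^ 'n::finite) measure) = density lborel (\<lambda>x. ennreal (gauss_density x))"
proof -
  let ?L = "PiM UNIV (\<lambda>_ :: 'n. lborel :: real measure)"
  let ?f = "\<lambda>x :: 'n \<Rightarrow> real. \<Prod>i\<in>UNIV. ennreal (std_normal_density (x i))"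
  interpret L: product_sigma_finite "\<lambda>_ :: 'n. lborel :: real measure"
    by standard
  interpret N: product_prob_space "\<lambda>_ :: 'n. density lborel std_normal_density" UNIV
    by (intro product_prob_spaceI prob_space_normal_density) simp
  have f [measurable]: "?f \<in> borel_measurable ?L"
    by measurable
  have "density ?L ?f = PiM UNIV (\<lambda>_ :: 'n. density lborel std_normal_density)"
  proof (rule N.PiM_eqI)
    show "sets (density ?L ?f) = sets (PiM UNIV (\<lambda>_ :: 'n. density lborel std_normal_density))"
      by (simp, intro sets_PiM_cong) auto
    fix A :: "'n \<Rightarrow> real set"
    assume "\<And>i. i \<in> UNIV \<Longrightarrow> A i \<in> sets (density lborel std_normal_density)"
    then have A [measurable]: "A i \<in> sets borel" for i
      by simp
    have AP: "PiE UNIV A \<in> sets ?L"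
      by (intro sets_PiM_I_finite) auto
    have "emeasure (density ?L ?f) (PiE UNIV A) = (\<integral>\<^sup>+x. ?f x * indicator (PiE UNIV A) x \<partial>?L)"
      by (rule emeasure_density[OF f AP])
    also have "\<dots> = (\<integral>\<^sup>+x. (\<Prod>i\<in>UNIV. ennreal (std_normal_density (x i)) * indicator (A i) (x i)) \<partial>?L)"
    proof (rule nn_integral_cong)
      fix x :: "'n \<Rightarrow> real"
      show "?f x * indicator (PiE UNIV A) x = (\<Prod>i\<in>UNIV. ennreal (std_normal_density (x i)) * indicator (A i) (x i))"
      proof (cases "x \<in> PiE UNIV A")
        case True
        then have "indicator (A i) (x i) = (1 :: ennreal)" for i
          by (auto simp: PiE_iff)
        with True show ?thesis by simp
      next
        case False
        then obtain i where "x i \<notin> A i"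
          by (auto simp: PiE_iff)
        then have "(\<Prod>i\<in>UNIV. ennreal (std_normal_density (x i)) * indicator (A i) (x i)) = 0"
          by (intro prod_zero bexI[of _ i]) auto
        with False show ?thesis by simp
      qed
    qed
    also have "\<dots> = (\<Prod>i\<in>UNIV. \<integral>\<^sup>+x. ennreal (std_normal_density x) * indicator (A i) x \<partial>lborel)"
      by (rule L.product_nn_integral_prod) auto
    also have "\<dots> = (\<Prod>i\<in>UNIV. emeasure (density lborel std_normal_density) (A i))"
      by (simp add: emeasure_density)
    finally show "emeasure (density ?L ?f) (PiE UNIV A)
        = (\<Prod>i\<in>UNIV. emeasure (density lborel std_normal_density) (A i))" .
  qed simp
  then have "std_gaussian = distr (density ?L ?f) borel (\<lambda>f. \<chi> i. f i)"
    by (simp add: std_gaussian_def)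
  also have "?f = (\<lambda>x. ennreal (gauss_density x)) \<circ> (\<lambda>f. \<chi> i. f i)"
    by (auto simp: gauss_density_eq_prod prod_ennreal)
  also have "distr (density ?L ((\<lambda>x. ennreal (gauss_density x)) \<circ> (\<lambda>f. \<chi> i. f i))) borel (\<lambda>f. \<chi> i. f i)
      = density (distr ?L borel (\<lambda>f. \<chi> i. f i)) (\<lambda>x. ennreal (gauss_density x))"
    unfolding comp_def by (rule density_distr[symmetric]) (auto intro: measurable_vec_PiM_lborel)
  finally show ?thesis
    by (simp add: lborel_vec_eq_distr_PiM)
qed

lemma nn_integral_lborel_affine:
  fixes f :: "'a::euclidean_space \<Rightarrow> ennreal"
  assumes [measurable]: "f \<in> borel_measurable borel" and "c \<noteq> 0"
  shows "(\<integral>\<^sup>+x. f x \<partial>lborel) = ennreal (\<bar>c\<bar> ^ DIM('a)) * (\<integral>\<^sup>+x. f (t + c *\<^sub>R x) \<partial>lborel)"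
  by (subst lborel_affine[OF assms(2), of t])
     (simp add: nn_integral_density nn_integral_distr nn_integral_cmult)

lemma nn_integral_gauss_density: "(\<integral>\<^sup>+x. ennreal (gauss_density (x :: real ^ 'n::finite)) \<partial>lborel) = 1"
proof -
  interpret prob_space "std_gaussian :: (real ^ 'n) measure"
    by (rule prob_space_std_gaussian)
  have "emeasure (std_gaussian :: (real ^ 'n) measure) UNIV = 1"
    using emeasure_space_1 by simp
  then show ?thesis
    by (simp add: std_gaussian_eq_density emeasure_density)
qed

text \<open>
  The product density of two independent Gaussian vectors depends only on the sum of the squared
  norms, which an orthogonal change of variables in the plane, applied coordinatewise, preserves.
\<close>
lemma gauss_density_orthogonal:
  fixes y u :: "real ^ 'n::finite"
  assumes "a\<^sup>2 + b\<^sup>2 = 1"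
  shows "gauss_density (a *\<^sub>R y + b *\<^sub>R u) * gauss_density (b *\<^sub>R y - a *\<^sub>R u)
    = gauss_density y * gauss_density u"
proof -
  have "(norm (a *\<^sub>R y + b *\<^sub>R u))\<^sup>2 + (norm (b *\<^sub>R y - a *\<^sub>R u))\<^sup>2
      = (a\<^sup>2 + b\<^sup>2) * (norm y)\<^sup>2 + (a\<^sup>2 + b\<^sup>2) * (norm u)\<^sup>2"
    unfolding power2_norm_eq_inner
    by (simp add: inner_add_left inner_add_right inner_diff_left inner_diff_right inner_commute
        algebra_simps power2_eq_square)
  then have "- (norm (a *\<^sub>R y + b *\<^sub>R u))\<^sup>2 / 2 + - (norm (b *\<^sub>R y - a *\<^sub>R u))\<^sup>2 / 2
      = - (norm y)\<^sup>2 / 2 + - (norm u)\<^sup>2 / 2"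
    using assms by simp
  then have "exp (- (norm (a *\<^sub>R y + b *\<^sub>R u))\<^sup>2 / 2) * exp (- (norm (b *\<^sub>R y - a *\<^sub>R u))\<^sup>2 / 2)
      = exp (- (norm y)\<^sup>2 / 2) * exp (- (norm u)\<^sup>2 / 2)"
    by (simp only: exp_add[symmetric])
  then show ?thesis
    by (simp add: gauss_density_def)
qed

text \<open>
  Two affine substitutions, first for \<open>w\<close> and then for \<open>z\<close>, amount to an orthogonal map of \<open>(z, w)\<close>,
  under which the law of a pair of independent standard Gaussian vectors is invariant. Their
  Jacobians \<open>c\<close> and \<open>1 / c\<close> cancel; multiplying the whole identity by \<open>c\<close> avoids inverses in the
  extended nonnegative reals.
\<close>
lemma nn_integral_gaussian_convolution:
  fixes F :: "real ^ 'n::finite \<Rightarrow> ennreal"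
  assumes [measurable]: "F \<in> borel_measurable borel" and ab: "a\<^sup>2 + b\<^sup>2 = 1" and b: "b \<noteq> 0"
  shows "(\<integral>\<^sup>+z. \<integral>\<^sup>+w. F (a *\<^sub>R z + b *\<^sub>R w) \<partial>std_gaussian \<partial>std_gaussian) = (\<integral>\<^sup>+y. F y \<partial>std_gaussian)"
proof -
  define p :: "real ^ 'n \<Rightarrow> ennreal" where "p x = ennreal (gauss_density x)" for x
  have p [measurable]: "p \<in> borel_measurable borel"
    unfolding p_def[abs_def] by measurable
  define c :: ennreal where "c = ennreal (\<bar>b\<bar> ^ DIM(real ^ 'n))"
  have c: "c \<noteq> 0" "c \<noteq> \<top>"
    using b by (auto simp: c_def)
  have rot: "p (a *\<^sub>R y + b *\<^sub>R u) * p ((1 / b) *\<^sub>R (y - a *\<^sub>R (a *\<^sub>R y + b *\<^sub>R u))) = p y * p u" for y u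
  proof -
    have "y - a *\<^sub>R (a *\<^sub>R y + b *\<^sub>R u) = (1 - a\<^sup>2) *\<^sub>R y - (a * b) *\<^sub>R u"
      by (simp add: algebra_simps power2_eq_square)
    also have "1 - a\<^sup>2 = b\<^sup>2"
      using ab by simp
    finally have "(1 / b) *\<^sub>R (y - a *\<^sub>R (a *\<^sub>R y + b *\<^sub>R u)) = b *\<^sub>R y - a *\<^sub>R u"
      using b by (simp add: scaleR_diff_right power2_eq_square)
    then show ?thesis
      using gauss_density_orthogonal[OF ab, of y u]
      by (simp add: p_def ennreal_mult[symmetric] less_imp_le[OF gauss_density_pos])
  qed
  have "c * (\<integral>\<^sup>+z. p z * (\<integral>\<^sup>+w. p w * F (a *\<^sub>R z + b *\<^sub>R w) \<partial>lborel) \<partial>lborel)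
      = (\<integral>\<^sup>+z. p z * (c * (\<integral>\<^sup>+w. p w * F (a *\<^sub>R z + b *\<^sub>R w) \<partial>lborel)) \<partial>lborel)"
    by (subst nn_integral_cmult[symmetric]) (auto simp: ac_simps)
  also have "\<dots> = (\<integral>\<^sup>+z. p z * (\<integral>\<^sup>+y. p ((1 / b) *\<^sub>R (y - a *\<^sub>R z)) * F y \<partial>lborel) \<partial>lborel)"
  proof (intro nn_integral_cong arg_cong[of _ _ "(*) _"])
    fix z :: "real ^ 'n"
    have "(\<integral>\<^sup>+y. p ((1 / b) *\<^sub>R (y - a *\<^sub>R z)) * F y \<partial>lborel)
        = c * (\<integral>\<^sup>+w. p ((1 / b) *\<^sub>R (a *\<^sub>R z + b *\<^sub>R w - a *\<^sub>R z)) * F (a *\<^sub>R z + b *\<^sub>R w) \<partial>lborel)"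
      unfolding c_def by (rule nn_integral_lborel_affine[OF _ b]) measurable
    then show "c * (\<integral>\<^sup>+w. p w * F (a *\<^sub>R z + b *\<^sub>R w) \<partial>lborel)
        = (\<integral>\<^sup>+y. p ((1 / b) *\<^sub>R (y - a *\<^sub>R z)) * F y \<partial>lborel)"
      using b by simp
  qed
  also have "\<dots> = (\<integral>\<^sup>+z. \<integral>\<^sup>+y. p z * (p ((1 / b) *\<^sub>R (y - a *\<^sub>R z)) * F y) \<partial>lborel \<partial>lborel)"
    by (intro nn_integral_cong nn_integral_cmult[symmetric]) measurable
  also have "\<dots> = (\<integral>\<^sup>+y. \<integral>\<^sup>+z. p z * (p ((1 / b) *\<^sub>R (y - a *\<^sub>R z)) * F y) \<partial>lborel \<partial>lborel)"
    by (rule lborel_pair.Fubini') measurable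
  also have "\<dots> = (\<integral>\<^sup>+y. c * (p y * F y) \<partial>lborel)"
  proof (rule nn_integral_cong)
    fix y :: "real ^ 'n"
    have "(\<integral>\<^sup>+z. p z * (p ((1 / b) *\<^sub>R (y - a *\<^sub>R z)) * F y) \<partial>lborel)
        = c * (\<integral>\<^sup>+u. p (a *\<^sub>R y + b *\<^sub>R u) * (p ((1 / b) *\<^sub>R (y - a *\<^sub>R (a *\<^sub>R y + b *\<^sub>R u))) * F y) \<partial>lborel)"
      unfolding c_def by (rule nn_integral_lborel_affine[OF _ b]) measurable
    also have "\<dots> = c * (\<integral>\<^sup>+u. (p y * F y) * p u \<partial>lborel)"
      unfolding mult.assoc[symmetric] rot by (simp only: ac_simps)
    also have "\<dots> = c * ((p y * F y) * (\<integral>\<^sup>+u. p u \<partial>lborel))"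
      by (subst nn_integral_cmult) auto
    also have "(\<integral>\<^sup>+u. p u \<partial>lborel) = 1"
      unfolding p_def by (rule nn_integral_gauss_density)
    finally show "(\<integral>\<^sup>+z. p z * (p ((1 / b) *\<^sub>R (y - a *\<^sub>R z)) * F y) \<partial>lborel) = c * (p y * F y)"
      by simp
  qed
  also have "\<dots> = c * (\<integral>\<^sup>+y. p y * F y \<partial>lborel)"
    by (rule nn_integral_cmult) measurable
  finally have "(\<integral>\<^sup>+z. p z * (\<integral>\<^sup>+w. p w * F (a *\<^sub>R z + b *\<^sub>R w) \<partial>lborel) \<partial>lborel) = (\<integral>\<^sup>+y. p y * F y \<partial>lborel)"
    using c by (simp add: ennreal_mult_cancel_left)
  then show ?thesis
    by (simp add: std_gaussian_eq_density nn_integral_density p_def)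
qed

lemma integral_gaussian_convolution:
  fixes F :: "real ^ 'n::finite \<Rightarrow> real"
  assumes F [measurable]: "F \<in> borel_measurable borel" and bdd: "\<And>x. \<bar>F x\<bar> \<le> c"
    and ab: "a\<^sup>2 + b\<^sup>2 = 1" and b: "b \<noteq> 0"
  shows "(\<integral>z. \<integral>w. F (a *\<^sub>R z + b *\<^sub>R w) \<partial>std_gaussian \<partial>std_gaussian) = (\<integral>y. F y \<partial>std_gaussian)"
proof -
  let ?G = "std_gaussian :: (real ^ 'n) measure"
  interpret G: prob_space ?G
    by (rule prob_space_std_gaussian)
  interpret P: pair_prob_space ?G ?G ..
  let ?T = "\<lambda>q :: (real ^ 'n) \<times> (real ^ 'n). a *\<^sub>R fst q + b *\<^sub>R snd q"
  have T [measurable]: "?T \<in> measurable (?G \<Otimes>\<^sub>M ?G) borel"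
    by measurable
  have "distr (?G \<Otimes>\<^sub>M ?G) borel ?T = ?G"
  proof (rule measure_eqI)
    fix A assume "A \<in> sets (distr (?G \<Otimes>\<^sub>M ?G) borel ?T)"
    then have [measurable]: "A \<in> sets borel" by simp
    have "emeasure (distr (?G \<Otimes>\<^sub>M ?G) borel ?T) A = (\<integral>\<^sup>+y. indicator A y \<partial>distr (?G \<Otimes>\<^sub>M ?G) borel ?T)"
      by simp
    also have "\<dots> = (\<integral>\<^sup>+q. indicator A (?T q) \<partial>(?G \<Otimes>\<^sub>M ?G))"
      by (rule nn_integral_distr) measurable
    also have "\<dots> = (\<integral>\<^sup>+z. \<integral>\<^sup>+w. indicator A (a *\<^sub>R z + b *\<^sub>R w) \<partial>?G \<partial>?G)"
      by (subst G.nn_integral_fst[symmetric]) auto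
    also have "\<dots> = (\<integral>\<^sup>+y. indicator A y \<partial>?G)"
      by (rule nn_integral_gaussian_convolution[OF _ ab b]) measurable
    finally show "emeasure (distr (?G \<Otimes>\<^sub>M ?G) borel ?T) A = emeasure ?G A"
      by simp
  qed simp
  then have "(\<integral>y. F y \<partial>?G) = (\<integral>y. F y \<partial>distr (?G \<Otimes>\<^sub>M ?G) borel ?T)"
    by simp
  also have "\<dots> = (\<integral>q. F (?T q) \<partial>(?G \<Otimes>\<^sub>M ?G))"
    by (rule integral_distr) measurable
  also have "\<dots> = (\<integral>z. \<integral>w. F (a *\<^sub>R z + b *\<^sub>R w) \<partial>?G \<partial>?G)"
  proof (subst P.integral_fst'[symmetric])
    show "integrable (?G \<Otimes>\<^sub>M ?G) (\<lambda>q. F (?T q))"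
      by (rule P.P.integrable_const_bound[where B = c]) (use bdd in auto)
  qed simp
  finally show ?thesis ..
qed

lemma integral_gaussian_uminus:
  fixes F :: "real ^ 'n::finite \<Rightarrow> real"
  assumes [measurable]: "F \<in> borel_measurable borel"
  shows "(\<integral>z. F (- z) \<partial>std_gaussian) = (\<integral>z. F z \<partial>std_gaussian)"
proof -
  have "distr std_gaussian borel uminus = (std_gaussian :: (real ^ 'n) measure)"
  proof (rule measure_eqI)
    fix A :: "(real ^ 'n) set" assume "A \<in> sets (distr std_gaussian borel uminus)"
    then have [measurable]: "A \<in> sets borel" by simp
    have "emeasure (distr std_gaussian borel uminus) A = (\<integral>\<^sup>+y. indicator A y \<partial>distr std_gaussian borel uminus)"
      by simp
    also have "\<dots> = (\<integral>\<^sup>+z. indicator A (- z) \<partial>std_gaussian)"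
      by (rule nn_integral_distr) measurable
    also have "\<dots> = (\<integral>\<^sup>+z. ennreal (gauss_density z) * indicator A (- z) \<partial>lborel)"
      by (simp add: std_gaussian_eq_density nn_integral_density)
    also have "\<dots> = (\<integral>\<^sup>+z. ennreal (gauss_density z) * indicator A z \<partial>lborel)"
      by (subst nn_integral_lborel_affine[where c = "-1" and t = 0]) (auto simp: gauss_density_def)
    also have "\<dots> = emeasure std_gaussian A"
      by (simp add: std_gaussian_eq_density emeasure_density)
    finally show "emeasure (distr std_gaussian borel uminus) A = emeasure std_gaussian A" .
  qed simp
  then have "(\<integral>z. F z \<partial>std_gaussian) = (\<integral>z. F z \<partial>distr std_gaussian borel uminus)"
    by simp
  also have "\<dots> = (\<integral>z. F (- z) \<partial>std_gaussian)"
    by (rule integral_distr) measurable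
  finally show ?thesis ..
qed

text \<open>
  Outside of the ball of radius \<open>r\<close>, one half of the exponent contributes at most the factor
  \<open>exp (- r\<^sup>2 / 4)\<close>, and the other half is, up to scaling, a Gaussian density again.
  The maximum principle needs a decay faster than \<open>1 / r\<^sup>2\<close>.
\<close>
lemma gaussian_tail:
  "measure (std_gaussian :: (real ^ 'n::finite) measure) {z. r \<le> norm z} \<le> sqrt 2 ^ CARD('n) * exp (- r\<^sup>2 / 4)"
  if "r \<ge> 0"
proof -
  interpret prob_space "std_gaussian :: (real ^ 'n) measure"
    by (rule prob_space_std_gaussian)
  let ?h = "\<lambda>z :: real ^ 'n. gauss_density ((1 / sqrt 2) *\<^sub>R z)"
  have "gauss_density z \<le> exp (- r\<^sup>2 / 4) * ?h z" if "r \<le> norm z" for z :: "real ^ 'n"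
  proof -
    have "r\<^sup>2 \<le> (norm z)\<^sup>2"
      using that \<open>r \<ge> 0\<close> by (intro power_mono)
    then have "exp (- (norm z)\<^sup>2 / 2) \<le> exp (- r\<^sup>2 / 4 + - (norm z)\<^sup>2 / 4)"
      by simp
    then have "exp (- (norm z)\<^sup>2 / 2) \<le> exp (- r\<^sup>2 / 4) * exp (- (norm z)\<^sup>2 / 4)"
      by (simp only: exp_add)
    then have "(1 / sqrt (2 * pi)) ^ CARD('n) * exp (- (norm z)\<^sup>2 / 2)
        \<le> (1 / sqrt (2 * pi)) ^ CARD('n) * (exp (- r\<^sup>2 / 4) * exp (- (norm z)\<^sup>2 / 4))"
      by (intro mult_left_mono) auto
    then show ?thesis
      by (simp add: gauss_density_def power_mult_distrib power_divide ac_simps)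
  qed
  then have "ennreal (gauss_density z) * indicator {z. r \<le> norm z} z
      \<le> ennreal (exp (- r\<^sup>2 / 4)) * ennreal (?h z)" for z :: "real ^ 'n"
    by (auto simp: ennreal_mult[symmetric] less_imp_le[OF gauss_density_pos] indicator_def intro!: ennreal_leI)
  then have "emeasure std_gaussian {z :: real ^ 'n. r \<le> norm z}
      \<le> (\<integral>\<^sup>+z. ennreal (exp (- r\<^sup>2 / 4)) * ennreal (?h z) \<partial>lborel)"
    by (simp add: std_gaussian_eq_density emeasure_density nn_integral_mono)
  also have "\<dots> = ennreal (exp (- r\<^sup>2 / 4)) * (\<integral>\<^sup>+z. ennreal (?h z) \<partial>lborel)"
    by (rule nn_integral_cmult) measurable
  also have "(\<integral>\<^sup>+z. ennreal (?h z) \<partial>lborel) = ennreal (sqrt 2 ^ CARD('n))"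
    by (subst nn_integral_lborel_affine[where c = "sqrt 2" and t = 0])
       (auto simp: nn_integral_gauss_density)
  finally have "emeasure std_gaussian {z :: real ^ 'n. r \<le> norm z} \<le> ennreal (exp (- r\<^sup>2 / 4) * sqrt 2 ^ CARD('n))"
    by (simp add: ennreal_mult)
  then show ?thesis
    by (simp add: emeasure_eq_measure ac_simps)
qed

lemma measure_gaussian_lower_bound:
  fixes A :: "(real ^ 'n::finite) set"
  assumes [measurable]: "A \<in> sets borel" and "A \<subseteq> cball 0 r"
  shows "(1 / sqrt (2 * pi)) ^ CARD('n) * exp (- r\<^sup>2 / 2) * measure lborel A \<le> measure std_gaussian A"
proof -
  interpret prob_space "std_gaussian :: (real ^ 'n) measure"
    by (rule prob_space_std_gaussian)
  let ?c = "(1 / sqrt (2 * pi)) ^ CARD('n) * exp (- r\<^sup>2 / 2)"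
  have fin: "emeasure lborel A \<noteq> \<infinity>"
    using assms(2) bounded_subset[OF bounded_cball] emeasure_bounded_finite[of A] by (auto simp: less_top)
  have "?c \<le> gauss_density x" if "x \<in> A" for x
  proof -
    have "norm x \<le> r" using that assms(2) by auto
    then have "(norm x)\<^sup>2 \<le> r\<^sup>2" by (intro power_mono) auto
    then show ?thesis by (simp add: gauss_density_def mult_left_mono)
  qed
  then have "(\<integral>\<^sup>+x. ennreal ?c * indicator A x \<partial>lborel) \<le> (\<integral>\<^sup>+x. ennreal (gauss_density x) * indicator A x \<partial>lborel)"
    by (intro nn_integral_mono) (auto simp: indicator_def intro!: ennreal_leI)
  then have "ennreal ?c * emeasure lborel A \<le> emeasure std_gaussian A"
    by (simp add: std_gaussian_eq_density emeasure_density nn_integral_cmult)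
  then have "ennreal (?c * measure lborel A) \<le> ennreal (measure std_gaussian A)"
    using fin by (simp add: emeasure_eq_measure emeasure_eq_ennreal_measure ennreal_mult)
  then show ?thesis
    by simp
qed

section \<open>The heat flow and its maximum principle\<close>

text \<open>
  The solution at time \<open>t\<close> of the heat equation \<open>\<partial>\<^sub>t u = (1/2) \<Delta> u\<close> with initial value \<open>F\<close>, that is, the mean
  of \<open>F\<close> over Brownian motion started at \<open>x\<close>.
\<close>
definition heat :: "(real ^ 'n::finite \<Rightarrow> real) \<Rightarrow> real \<Rightarrow> real ^ 'n \<Rightarrow> real" where
  "heat F t x = (\<integral>z. F (x + sqrt t *\<^sub>R z) \<partial>std_gaussian)"

lemma integrable_gaussian_bounded:
  fixes F :: "real ^ 'n::finite \<Rightarrow> real"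
  assumes "F \<in> borel_measurable borel" and "\<And>x. \<bar>F x\<bar> \<le> c"
  shows "integrable std_gaussian F"
proof -
  interpret prob_space "std_gaussian :: (real ^ 'n) measure"
    by (rule prob_space_std_gaussian)
  show ?thesis
    by (rule integrable_const_bound[where B = c]) (use assms in auto)
qed

lemma heat_0 [simp]:
  fixes F :: "real ^ 'n::finite \<Rightarrow> real"
  shows "heat F 0 x = F x"
proof -
  interpret prob_space "std_gaussian :: (real ^ 'n) measure"
    by (rule prob_space_std_gaussian)
  show ?thesis
    using prob_space by (simp add: heat_def)
qed

lemma heat_le:
  fixes F :: "real ^ 'n::finite \<Rightarrow> real"
  assumes F [measurable]: "F \<in> borel_measurable borel" and bdd: "\<And>x. \<bar>F x\<bar> \<le> c"
  shows "\<bar>heat F t x\<bar> \<le> c"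
proof -
  interpret prob_space "std_gaussian :: (real ^ 'n) measure"
    by (rule prob_space_std_gaussian)
  have int: "integrable std_gaussian (\<lambda>z. F (x + sqrt t *\<^sub>R z))"
    by (rule integrable_gaussian_bounded[where c = c]) (use bdd in auto)
  have "F y \<le> c" "- c \<le> F y" for y
    using bdd[of y] by linarith+
  then have "heat F t x \<le> c" "- c \<le> heat F t x"
    unfolding heat_def by (intro integral_le_const integral_ge_const int; simp)+
  then show ?thesis
    by linarith
qed

lemma continuous_on_heat:
  fixes F :: "real ^ 'n::finite \<Rightarrow> real"
  assumes F: "continuous_on UNIV F" and bdd: "\<And>x. \<bar>F x\<bar> \<le> c"
  shows "continuous_on UNIV (\<lambda>p. heat F (fst p) (snd p))"
proof (rule continuous_on_sequentiallyI)
  interpret prob_space "std_gaussian :: (real ^ 'n) measure"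
    by (rule prob_space_std_gaussian)
  have [measurable]: "F \<in> borel_measurable borel"
    using F by (rule borel_measurable_continuous_onI)
  fix u :: "nat \<Rightarrow> real \<times> (real ^ 'n)" and a
  assume u: "u \<longlonglongrightarrow> a"
  show "(\<lambda>k. heat F (fst (u k)) (snd (u k))) \<longlonglongrightarrow> heat F (fst a) (snd a)"
    unfolding heat_def
  proof (rule integral_dominated_convergence[where w = "\<lambda>_. c"])
    have "(\<lambda>k. F (snd (u k) + sqrt (fst (u k)) *\<^sub>R z)) \<longlonglongrightarrow> F (snd a + sqrt (fst a) *\<^sub>R z)" for z
    proof (rule isCont_tendsto_compose[where g = F])
      show "isCont F (snd a + sqrt (fst a) *\<^sub>R z)"
        using F by (simp add: continuous_on_eq_continuous_at)
      show "(\<lambda>k. snd (u k) + sqrt (fst (u k)) *\<^sub>R z) \<longlonglongrightarrow> snd a + sqrt (fst a) *\<^sub>R z"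
        by (intro tendsto_intros u)
    qed
    then show "AE z in std_gaussian. (\<lambda>k. F (snd (u k) + sqrt (fst (u k)) *\<^sub>R z))
        \<longlonglongrightarrow> F (snd a + sqrt (fst a) *\<^sub>R z)"
      by simp
  qed (use bdd in auto)
qed

lemma heat_semigroup:
  fixes F :: "real ^ 'n::finite \<Rightarrow> real"
  assumes [measurable]: "F \<in> borel_measurable borel" and bdd: "\<And>x. \<bar>F x\<bar> \<le> c"
    and s: "0 \<le> s" "s < t"
  shows "heat F t x = (\<integral>z. heat F (t - s) (x + sqrt s *\<^sub>R z) \<partial>std_gaussian)"
proof -
  define a b where "a = sqrt (s / t)" and "b = sqrt ((t - s) / t)"
  have ab: "a\<^sup>2 + b\<^sup>2 = 1" "b \<noteq> 0"
    using s by (auto simp: a_def b_def field_simps)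
  have *: "sqrt t * a = sqrt s" "sqrt t * b = sqrt (t - s)"
    using s by (simp_all add: a_def b_def real_sqrt_mult[symmetric])
  have "heat F t x = (\<integral>z. \<integral>w. F (x + sqrt t *\<^sub>R (a *\<^sub>R z + b *\<^sub>R w)) \<partial>std_gaussian \<partial>std_gaussian)"
    unfolding heat_def by (rule integral_gaussian_convolution[symmetric, OF _ _ ab]) (use bdd in auto)
  also have "(\<lambda>z w. F (x + sqrt t *\<^sub>R (a *\<^sub>R z + b *\<^sub>R w)))
      = (\<lambda>z w. F ((x + sqrt s *\<^sub>R z) + sqrt (t - s) *\<^sub>R w))"
    by (simp add: scaleR_add_right * add.assoc)
  finally show ?thesis
    by (simp add: heat_def)
qed

text \<open>
  The maximum principle for the heat flow on a compact set \<open>K\<close>, by a mean value argument that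
  replaces derivatives by the semigroup property. Suppose that \<open>heat F t x - \<epsilon> * t\<close> has a positive
  maximum over \<open>[0, T] \<times> K\<close>. It can only be attained at a time \<open>t0 > 0\<close> and at an interior point \<open>x0\<close>.
  Going back from there by a short time \<open>s\<close> expresses the value at \<open>(t0, x0)\<close> as a Gaussian mean of
  values at time \<open>t0 - s\<close>. Those at points of \<open>K\<close> do not exceed the maximum, so the mean loses
  \<open>\<epsilon> * s\<close>, and the points outside of \<open>K\<close> cannot make up for it, because their probability is
  \<open>o(s)\<close> by the Gaussian tail bound.
\<close>
theorem heat_maximum_principle:
  fixes F :: "real ^ 'n::finite \<Rightarrow> real"
  assumes F: "continuous_on UNIV F" and bdd: "\<And>x. \<bar>F x\<bar> \<le> c"
    and K: "compact K"
    and initial: "\<And>x. x \<in> K \<Longrightarrow> F x \<le> 0"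
    and lateral: "\<And>t x. 0 \<le> t \<Longrightarrow> t \<le> T \<Longrightarrow> x \<in> frontier K \<Longrightarrow> heat F t x \<le> 0"
    and t: "0 \<le> t" "t \<le> T" and x: "x \<in> K"
  shows "heat F t x \<le> 0"
proof (rule ccontr)
  interpret prob_space "std_gaussian :: (real ^ 'n) measure"
    by (rule prob_space_std_gaussian)
  have F_meas [measurable]: "F \<in> borel_measurable borel"
    using F by (rule borel_measurable_continuous_onI)
  assume "\<not> heat F t x \<le> 0"
  then have pos: "heat F t x > 0" by simp
  define \<epsilon> where "\<epsilon> = heat F t x / (2 * (T + 1))"
  have \<epsilon>: "\<epsilon> > 0"
    using pos t by (simp add: \<epsilon>_def)
  have "\<epsilon> * t \<le> \<epsilon> * (T + 1)"
    using t \<epsilon> by (intro mult_left_mono) auto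
  also have "\<dots> = heat F t x / 2"
    using t by (simp add: \<epsilon>_def field_simps)
  finally have pos': "heat F t x - \<epsilon> * t > 0"
    using pos by linarith
  have cont: "continuous_on ({0..T} \<times> K) (\<lambda>p. heat F (fst p) (snd p) - \<epsilon> * fst p)"
    by (intro continuous_intros continuous_on_subset[OF continuous_on_heat[OF F bdd]]) auto
  have "compact ({0..T} \<times> K)"
    by (rule compact_Times[OF compact_Icc K])
  moreover have "{0..T} \<times> K \<noteq> {}"
    using t x by auto
  ultimately obtain p0 where p0: "p0 \<in> {0..T} \<times> K"
    "\<And>p. p \<in> {0..T} \<times> K \<Longrightarrow> heat F (fst p) (snd p) - \<epsilon> * fst p \<le> heat F (fst p0) (snd p0) - \<epsilon> * fst p0"
    using continuous_attains_sup[OF _ _ cont] by blast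
  obtain t0 x0 where "p0 = (t0, x0)" by (cases p0)
  with p0 have t0: "0 \<le> t0" "t0 \<le> T" and x0: "x0 \<in> K"
    and max: "\<And>t x. 0 \<le> t \<Longrightarrow> t \<le> T \<Longrightarrow> x \<in> K \<Longrightarrow> heat F t x - \<epsilon> * t \<le> heat F t0 x0 - \<epsilon> * t0"
    by auto
  define m where "m = heat F t0 x0 - \<epsilon> * t0"
  have m: "m > 0"
    using max[OF t x] pos' by (simp add: m_def)
  have "t0 \<noteq> 0"
    using m initial[OF x0] by (auto simp: m_def)
  with t0 have t0_pos: "t0 > 0" by simp
  have "\<epsilon> * t0 \<ge> 0" using \<epsilon> t0 by simp
  then have "x0 \<notin> frontier K"
    using m lateral[OF t0] by (force simp: m_def)
  then have "x0 \<in> interior K"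
    using x0 closure_subset[of K] by (auto simp: frontier_def)
  then obtain \<rho> where \<rho>: "\<rho> > 0" "ball x0 \<rho> \<subseteq> K"
    by (auto simp: mem_interior)
  have c: "c \<ge> 0" using bdd[of 0] by linarith
  let ?A = "c * sqrt 2 ^ CARD('n)"
  \<comment> \<open>A loss linear in \<open>s\<close> against a gain that is exponentially small in \<open>1 / s\<close>.\<close>
  have small: "\<epsilon> * s \<le> ?A * exp (- \<rho>\<^sup>2 / (4 * s))" if s: "0 < s" "s < t0" for s
  proof -
    let ?E = "{z :: real ^ 'n. \<rho> / sqrt s \<le> norm z}"
    \<comment> \<open>Where the displaced point may have left \<open>K\<close>, only the global bound \<open>c\<close> is available; \<open>m > 0\<close>
      makes it a valid bound after adding \<open>m\<close>.\<close>
    have le: "heat F (t0 - s) (x0 + sqrt s *\<^sub>R z) \<le> (m + \<epsilon> * (t0 - s)) + c * indicator ?E z" for z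
    proof (cases "z \<in> ?E")
      case True
      have "heat F (t0 - s) (x0 + sqrt s *\<^sub>R z) \<le> c"
        using heat_le[OF F_meas bdd] abs_le_D1 by blast
      moreover have "\<epsilon> * (t0 - s) > 0" using \<epsilon> s by simp
      ultimately show ?thesis using True m by simp
    next
      case False
      then have "norm (sqrt s *\<^sub>R z) < \<rho>"
        using s by (simp add: field_simps)
      then have "x0 + sqrt s *\<^sub>R z \<in> K"
        using \<rho>(2) by (intro subsetD[OF \<rho>(2)]) (simp add: dist_norm)
      with max[of "t0 - s" "x0 + sqrt s *\<^sub>R z"] False show ?thesis
        using s t0 by (simp add: m_def)
    qed
    have cont: "continuous_on UNIV (\<lambda>z. heat F (t0 - s) (x0 + sqrt s *\<^sub>R z))"
    proof -
      have "continuous_on UNIV (\<lambda>z. (t0 - s, x0 + sqrt s *\<^sub>R z))"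
        by (intro continuous_intros)
      from continuous_on_compose2[OF continuous_on_heat[OF F bdd] this] show ?thesis
        by simp
    qed
    have "integrable std_gaussian (\<lambda>z. heat F (t0 - s) (x0 + sqrt s *\<^sub>R z))"
      by (rule integrable_gaussian_bounded[OF borel_measurable_continuous_onI[OF cont] heat_le[OF F_meas bdd]])
    moreover have ind: "integrable std_gaussian (indicator ?E :: _ \<Rightarrow> real)"
      by (rule integrable_real_indicator) (simp_all add: emeasure_eq_measure)
    then have "integrable std_gaussian (\<lambda>z. (m + \<epsilon> * (t0 - s)) + c * indicator ?E z)"
      by (intro Bochner_Integration.integrable_add integrable_const integrable_mult_right)
    ultimately have "heat F t0 x0 \<le> (\<integral>z. (m + \<epsilon> * (t0 - s)) + c * indicator ?E z \<partial>std_gaussian)"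
      unfolding heat_semigroup[OF F_meas bdd less_imp_le[OF s(1)] s(2)] using le by (rule integral_mono)
    also have "\<dots> = m + \<epsilon> * (t0 - s) + c * measure std_gaussian ?E"
      using prob_space ind by (simp add: Bochner_Integration.integral_add)
    also have "measure std_gaussian ?E \<le> sqrt 2 ^ CARD('n) * exp (- (\<rho> / sqrt s)\<^sup>2 / 4)"
      using \<rho> s by (intro gaussian_tail) auto
    then have "m + \<epsilon> * (t0 - s) + c * measure std_gaussian ?E
        \<le> m + \<epsilon> * (t0 - s) + c * (sqrt 2 ^ CARD('n) * exp (- (\<rho> / sqrt s)\<^sup>2 / 4))"
      using c by (intro add_left_mono mult_left_mono)
    finally show ?thesis
      using s by (simp add: m_def power_divide algebra_simps)
  qed
  have "((\<lambda>s. ?A * exp (- \<rho>\<^sup>2 / (4 * s)) / s) \<longlongrightarrow> 0) (at_right 0)"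
    using \<rho>(1) by real_asymp
  then have "eventually (\<lambda>s. ?A * exp (- \<rho>\<^sup>2 / (4 * s)) / s < \<epsilon>) (at_right 0)"
    using \<epsilon> by (rule order_tendstoD)
  moreover have "eventually (\<lambda>s. 0 < s \<and> s < t0) (at_right 0)"
    using t0_pos by (auto simp: eventually_at_right_field)
  ultimately have "eventually (\<lambda>s :: real. False) (at_right 0)"
  proof eventually_elim
    case (elim s)
    then show ?case using small[of s] by (simp add: field_simps)
  qed
  then show False by simp
qed

lemma gaussian_cball_uniform_lower_bound:
  fixes \<rho> r :: real
  assumes "\<rho> \<ge> 0" "r > 0"
  obtains c where "c > 0" "\<And>x :: real ^ 'n::finite. norm x \<le> \<rho> \<Longrightarrow> c \<le> measure std_gaussian (cball x r)"
proof
  let ?c = "(1 / sqrt (2 * pi)) ^ CARD('n) * exp (- (\<rho> + r)\<^sup>2 / 2)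
      * (unit_ball_vol (real CARD('n)) * r ^ CARD('n))"
  show "?c > 0"
    using assms by (simp add: unit_ball_vol_pos)
  fix x :: "real ^ 'n" assume "norm x \<le> \<rho>"
  then have "cball x r \<subseteq> cball 0 (\<rho> + r)"
    unfolding cball_subset_cball_iff by simp
  from measure_gaussian_lower_bound[OF _ this] show "?c \<le> measure std_gaussian (cball x r)"
    using assms by (simp add: content_cball)
qed

section \<open>Comparison of a set with its sphere neighbourhood\<close>

definition bump :: "real \<Rightarrow> 'a::metric_space set \<Rightarrow> 'a \<Rightarrow> real" where
  "bump d A x = max 0 (1 - infdist x A / d)"

lemma continuous_on_bump: "continuous_on UNIV (bump d A)"
  unfolding bump_def[abs_def] divide_inverse by (intro continuous_intros)

lemma measurable_bump [measurable]: "bump d A \<in> borel_measurable borel"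
  by (rule borel_measurable_continuous_onI[OF continuous_on_bump])

lemma bump_bounds: "d > 0 \<Longrightarrow> 0 \<le> bump d A x" "d > 0 \<Longrightarrow> bump d A x \<le> 1"
  by (auto simp: bump_def infdist_nonneg)

lemma bump_in: "x \<in> A \<Longrightarrow> bump d A x = 1"
  by (simp add: bump_def)

lemma bump_tendsto_indicator:
  assumes "closed A" "A \<noteq> {}"
  shows "(\<lambda>k. bump (1 / real (Suc k)) A x) \<longlonglongrightarrow> indicator A x"
proof (cases "x \<in> A")
  case True
  then show ?thesis by (simp add: bump_in)
next
  case False
  then have pos: "infdist x A > 0"
    using assms in_closed_iff_infdist_zero[of A x] infdist_nonneg[of x A] by (auto simp: less_le)
  have "filterlim (\<lambda>k. infdist x A * real (Suc k)) at_top sequentially"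
    by (intro filterlim_tendsto_pos_mult_at_top[OF tendsto_const pos]
          filterlim_compose[OF filterlim_real_sequentially filterlim_Suc])
  then have "eventually (\<lambda>k. infdist x A * real (Suc k) \<ge> 1) sequentially"
    by (simp add: filterlim_at_top)
  then have "eventually (\<lambda>k. bump (1 / real (Suc k)) A x = indicator A x) sequentially"
    by eventually_elim (use False in \<open>simp add: bump_def\<close>)
  then show ?thesis by (rule tendsto_eventually)
qed

lemma integral_bump_tendsto:
  fixes A :: "(real ^ 'n::finite) set"
  assumes "closed A" "A \<noteq> {}"
  shows "(\<lambda>k. \<integral>x. bump (1 / real (Suc k)) A x \<partial>std_gaussian) \<longlonglongrightarrow> measure std_gaussian A"
proof -
  interpret prob_space "std_gaussian :: (real ^ 'n) measure"
    by (rule prob_space_std_gaussian)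
  have [measurable]: "A \<in> sets borel"
    using assms by simp
  have "(\<lambda>k. \<integral>x. bump (1 / real (Suc k)) A x \<partial>std_gaussian) \<longlonglongrightarrow> (\<integral>x. indicator A x \<partial>std_gaussian)"
  proof (rule integral_dominated_convergence[where w = "\<lambda>_. 1"])
    show "AE x in std_gaussian. (\<lambda>k. bump (1 / real (Suc k)) A x) \<longlonglongrightarrow> indicator A x"
      using bump_tendsto_indicator[OF assms] by simp
    show "AE x in std_gaussian. norm (bump (1 / real (Suc k)) A x) \<le> 1" for k
      using bump_bounds[of "1 / real (Suc k)" A] by simp
  qed auto
  then show ?thesis by simp
qed

text \<open>
  For the approximating functions this is the relation between \<open>K\<close> and \<open>K + S\<close>: a translation by
  \<open>v \<in> S\<close> takes the point of \<open>K\<close> nearest to \<open>x\<close> to a point of \<open>K + S\<close> at the same distance from \<open>x + v\<close>.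
\<close>
lemma bump_translate_le:
  fixes K S :: "'a::euclidean_space set"
  assumes "closed K" "K \<noteq> {}" "v \<in> S" "d > 0"
  shows "bump d K x \<le> bump d {k + s |k s. k \<in> K \<and> s \<in> S} (x + v)"
proof -
  obtain k where k: "k \<in> K" "infdist x K = dist x k"
    using infdist_attains_inf[OF assms(1,2)] by metis
  then have "k + v \<in> {k + s |k s. k \<in> K \<and> s \<in> S}"
    using assms(3) by blast
  then have "infdist (x + v) {k + s |k s. k \<in> K \<and> s \<in> S} \<le> dist (x + v) (k + v)"
    by (rule infdist_le)
  then have "infdist (x + v) {k + s |k s. k \<in> K \<and> s \<in> S} \<le> infdist x K"
    using k by simp
  then show ?thesis
    using assms(4) by (simp add: bump_def max.coboundedI2 divide_right_mono)
qed

text \<open>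
  The maximum principle on the ball of radius \<open>R / 2\<close>, applied to the comparison of the flow of \<open>f\<close> at
  \<open>x\<close> with that of \<open>g\<close> at the reflected point \<open>- x\<close>. On the boundary the flow of \<open>b\<close> is at
  least \<open>c\<close>, which pays for the summand \<open>c * (1 - b)\<close>; this summand is the source of strictness in
  the final theorem.
\<close>
lemma gaussian_bump_inequality:
  fixes K :: "(real ^ 'n::finite) set" and R c d :: real
  defines "L \<equiv> {k + s |k s. k \<in> K \<and> s \<in> sphere 0 R}"
  assumes R: "R > 0" and K: "compact K" "K \<noteq> {}" and d: "d > 0" and c: "c > 0"
    and cball: "\<And>x :: real ^ 'n. norm x = R / 2 \<Longrightarrow> c \<le> measure std_gaussian (cball x (R / 2))"
  shows "(\<integral>z. bump d K z \<partial>std_gaussian) + c * (1 - (\<integral>z. bump d (cball 0 (R / 2)) (z :: real ^ 'n) \<partial>std_gaussian))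
    \<le> (\<integral>z. bump d L z \<partial>std_gaussian) + (\<integral>z. bump d (cball 0 (R / 2)) (z :: real ^ 'n) \<partial>std_gaussian)"
proof -
  interpret prob_space "std_gaussian :: (real ^ 'n) measure"
    by (rule prob_space_std_gaussian)
  let ?B = "cball 0 (R / 2) :: (real ^ 'n) set"
  define f g b where "f = bump d K" and "g = bump d L" and "b = bump d ?B"
  define F where "F x = f x - g (- x) - b x + c * (1 - b x)" for x
  have meas [measurable]: "f \<in> borel_measurable borel" "g \<in> borel_measurable borel" "b \<in> borel_measurable borel"
    by (simp_all add: f_def g_def b_def)
  have bounds: "0 \<le> f x" "f x \<le> 1" "0 \<le> g x" "g x \<le> 1" "0 \<le> b x" "b x \<le> 1" for x
    using bump_bounds[OF d] by (simp_all add: f_def g_def b_def)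
  have int: "integrable std_gaussian (\<lambda>z. h (T z))"
    if "h = f \<or> h = g \<or> h = b" "T \<in> borel_measurable borel" for h and T :: "real ^ 'n \<Rightarrow> real ^ 'n"
  proof (rule integrable_gaussian_bounded[where c = 1])
    show "\<bar>h (T z)\<bar> \<le> 1" for z
      using that(1) bounds[of "T z"] by auto
  qed (use that in auto)
  have heat_F: "heat F t x = (\<integral>z. f (x + sqrt t *\<^sub>R z) \<partial>std_gaussian) - (\<integral>z. g (- x + sqrt t *\<^sub>R z) \<partial>std_gaussian)
      - (\<integral>z. b (x + sqrt t *\<^sub>R z) \<partial>std_gaussian) + c * (1 - (\<integral>z. b (x + sqrt t *\<^sub>R z) \<partial>std_gaussian))" for t x
  proof -
    have "heat F t x = (\<integral>z. f (x + sqrt t *\<^sub>R z) \<partial>std_gaussian) - (\<integral>z. g (- (x + sqrt t *\<^sub>R z)) \<partial>std_gaussian)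
      - (\<integral>z. b (x + sqrt t *\<^sub>R z) \<partial>std_gaussian) + c * (1 - (\<integral>z. b (x + sqrt t *\<^sub>R z) \<partial>std_gaussian))"
      unfolding heat_def F_def using prob_space
        int[of f "\<lambda>z. x + sqrt t *\<^sub>R z"] int[of g "\<lambda>z. - (x + sqrt t *\<^sub>R z)"]
        int[of b "\<lambda>z. x + sqrt t *\<^sub>R z"]
      by simp
    also have "(\<integral>z. g (- (x + sqrt t *\<^sub>R z)) \<partial>std_gaussian) = (\<integral>z. g (- x + sqrt t *\<^sub>R (- z)) \<partial>std_gaussian)"
      by simp
    also have "\<dots> = (\<integral>z. g (- x + sqrt t *\<^sub>R z) \<partial>std_gaussian)"
      by (rule integral_gaussian_uminus) measurable
    finally show ?thesis .
  qed
  have "heat F 1 0 \<le> 0"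
  proof (rule heat_maximum_principle[where K = ?B and T = 1 and c = "3 + c"])
    show "continuous_on UNIV F"
      unfolding F_def f_def g_def b_def
      by (intro continuous_intros continuous_on_bump continuous_on_compose2[OF continuous_on_bump]) auto
    show "\<bar>F x\<bar> \<le> 3 + c" for x
    proof -
      have "0 \<le> c * (1 - b x)" "c * (1 - b x) \<le> c"
        using bounds[of x] c by (auto simp: mult_le_cancel_left1)
      then show ?thesis
        using bounds[of x] bounds[of "- x"] by (simp add: F_def abs_le_iff)
    qed
    show "F x \<le> 0" if "x \<in> ?B" for x
      using bounds[of x] bounds[of "- x"] bump_in[OF that, of d] by (simp add: F_def b_def)
    show "heat F t x \<le> 0" if t: "0 \<le> t" "t \<le> 1" and "x \<in> frontier ?B" for t x
    proof -
      have x: "norm x = R / 2"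
        using that(3) R by (simp add: frontier_cball)
      have "f (x + sqrt t *\<^sub>R z) \<le> g (- x + sqrt t *\<^sub>R z)" for z
      proof -
        have "- 2 *\<^sub>R x \<in> sphere 0 R"
          using x by simp
        moreover have "x + sqrt t *\<^sub>R z + - 2 *\<^sub>R x = - x + sqrt t *\<^sub>R z"
          using scaleR_2[of x] by simp
        ultimately show ?thesis
          using bump_translate_le[OF compact_imp_closed[OF K(1)] K(2) _ d, of "- 2 *\<^sub>R x" "sphere 0 R"
            "x + sqrt t *\<^sub>R z"]
          unfolding f_def g_def L_def by (simp only:)
      qed
      then have fg: "(\<integral>z. f (x + sqrt t *\<^sub>R z) \<partial>std_gaussian) \<le> (\<integral>z. g (- x + sqrt t *\<^sub>R z) \<partial>std_gaussian)"
        by (intro integral_mono int) auto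
      \<comment> \<open>By convexity, a step \<open>z\<close> that leads from \<open>x\<close> into the ball may be shortened to \<open>sqrt t *\<^sub>R z\<close>, so
        one lower bound serves all times up to 1.\<close>
      have "indicator (cball (- x) (R / 2)) z \<le> b (x + sqrt t *\<^sub>R z)" for z
      proof (cases "z \<in> cball (- x) (R / 2)")
        case True
        then have "norm (x + z) \<le> R / 2"
          unfolding norm_minus_cancel[of "x + z", symmetric] by (simp add: dist_norm)
        then have "x + z \<in> ?B" "x \<in> ?B"
          using x by auto
        then have "(1 - sqrt t) *\<^sub>R x + sqrt t *\<^sub>R (x + z) \<in> ?B"
          using t by (intro convexD[OF convex_cball]) auto
        then have "x + sqrt t *\<^sub>R z \<in> ?B"
          by (simp add: algebra_simps)
        then show ?thesis
          by (simp add: b_def bump_in)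
      qed (use bounds in auto)
      then have "(\<integral>z. indicator (cball (- x) (R / 2)) z \<partial>std_gaussian) \<le> (\<integral>z. b (x + sqrt t *\<^sub>R z) \<partial>std_gaussian)"
        by (intro integral_mono int integrable_real_indicator) (auto simp: emeasure_eq_measure)
      then have b_ge: "c \<le> (\<integral>z. b (x + sqrt t *\<^sub>R z) \<partial>std_gaussian)"
        using cball[of "- x"] x by simp
      have "c * (1 - (\<integral>z. b (x + sqrt t *\<^sub>R z) \<partial>std_gaussian)) \<le> c * 1"
        using c b_ge by (intro mult_left_mono) auto
      with fg b_ge show ?thesis
        unfolding heat_F by linarith
    qed
  qed (use R in auto)
  then show ?thesis
    unfolding heat_F f_def g_def b_def by simp
qed

lemma gaussian_compact_inequality:
  fixes K :: "(real ^ 'n::finite) set"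
  assumes R: "R > 0" and K: "compact K" "K \<noteq> {}" and c: "c > 0"
    and cball: "\<And>x :: real ^ 'n. norm x = R / 2 \<Longrightarrow> c \<le> measure std_gaussian (cball x (R / 2))"
  shows "measure std_gaussian K + c * (1 - measure std_gaussian (cball 0 (R / 2) :: (real ^ 'n) set))
    \<le> measure std_gaussian {k + s |k s. k \<in> K \<and> s \<in> sphere 0 R} + measure std_gaussian (cball 0 (R / 2) :: (real ^ 'n) set)"
proof -
  let ?L = "{k + s |k s. k \<in> K \<and> s \<in> sphere (0 :: real ^ 'n) R}"
  obtain v :: "real ^ 'n" where "norm v = R"
    using vector_choose_size[of R] R by auto
  then have "v \<in> sphere 0 R" by simp
  then have L: "closed ?L" "?L \<noteq> {}"
    using compact_sums[OF K(1) compact_sphere[of 0 R]] K(2) by (auto intro: compact_imp_closed)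
  have B: "closed (cball 0 (R / 2) :: (real ^ 'n) set)" "cball 0 (R / 2) \<noteq> ({} :: (real ^ 'n) set)"
    using R by auto
  note lim_K = integral_bump_tendsto[OF compact_imp_closed[OF K(1)] K(2)]
  note lim_L = integral_bump_tendsto[OF L]
  note lim_B = integral_bump_tendsto[OF B]
  show ?thesis
    by (rule tendsto_le[OF sequentially_bot tendsto_add[OF lim_L lim_B]
          tendsto_add[OF lim_K tendsto_mult[OF tendsto_const tendsto_diff[OF tendsto_const lim_B]]]])
      (intro always_eventually allI gaussian_bump_inequality R K c cball, simp_all)
qed

(* The Minkowski sum of a Borel set and a sphere is in general only an analytic set, which is
   measurable for the completion of the Gaussian measure but need not be Borel; hence the
   completion in the second term. *)
theorem corollary2:
  fixes R :: real and \<Omega> :: "(real ^ 'n::finite) set"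
  assumes "R > 0" and "\<Omega> \<in> sets borel"
  shows "measure std_gaussian (- \<Omega>)
         + measure (completion std_gaussian) {\<omega> + \<theta> |\<omega> \<theta>. \<omega> \<in> \<Omega> \<and> \<theta> \<in> sphere 0 R}
         > 1 - measure (std_gaussian :: (real ^ 'n) measure) (cball 0 (R / 2))"
proof -
  let ?\<gamma> = "std_gaussian :: (real ^ 'n) measure"
  let ?B = "cball 0 (R / 2) :: (real ^ 'n) set"
  let ?S = "sphere 0 R :: (real ^ 'n) set"
  let ?D = "{\<omega> + \<theta> |\<omega> \<theta>. \<omega> \<in> \<Omega> \<and> \<theta> \<in> ?S}"
  interpret prob_space ?\<gamma>
    by (rule prob_space_std_gaussian)
  interpret completion: prob_space "completion ?\<gamma>"
    by (rule prob_space_completion)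
  have compl: "measure ?\<gamma> (- \<Omega>) = 1 - measure ?\<gamma> \<Omega>"
    using prob_compl[of \<Omega>] assms(2) by (simp add: Compl_eq_Diff_UNIV)
  obtain c where c: "c > 0" and c_le: "\<And>x :: real ^ 'n. norm x \<le> R / 2 \<Longrightarrow> c \<le> measure ?\<gamma> (cball x (R / 2))"
    using gaussian_cball_uniform_lower_bound[of "R / 2" "R / 2"] assms(1) by (metis half_gt_zero less_imp_le)
  have B_pos: "measure ?\<gamma> ?B > 0"
    using c c_le[of 0] assms(1) by simp
  have B_less: "measure ?\<gamma> ?B < 1"
  proof -
    obtain v :: "real ^ 'n" where v: "norm v = R"
      using vector_choose_size[of R] assms(1) by auto
    obtain e where e: "e > 0" "\<And>x :: real ^ 'n. norm x \<le> R \<Longrightarrow> e \<le> measure ?\<gamma> (cball x (R / 4))"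
      using gaussian_cball_uniform_lower_bound[of R "R / 4"] assms(1) by (auto simp: less_imp_le)
    have "?B \<inter> cball v (R / 4) = {}"
    proof (rule ccontr)
      assume "?B \<inter> cball v (R / 4) \<noteq> {}"
      then obtain y where "norm y \<le> R / 2" "norm (v - y) \<le> R / 4"
        by (auto simp: dist_norm)
      then show False
        using norm_triangle_sub[of v y] v assms(1) by simp
    qed
    then have "measure ?\<gamma> ?B + measure ?\<gamma> (cball v (R / 4)) = measure ?\<gamma> (?B \<union> cball v (R / 4))"
      by (intro finite_measure_Union[symmetric]) auto
    also have "\<dots> \<le> 1" by (rule prob_le_1)
    finally show ?thesis
      using e(1) e(2)[of v] v by simp
  qed
  show ?thesis
  proof (cases "\<Omega> = {}")
    case True
    then show ?thesis using B_pos prob_space by simp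
  next
    case False
    then obtain w where w: "w \<in> \<Omega>" by blast
    define \<epsilon> where "\<epsilon> = c * (1 - measure ?\<gamma> ?B)"
    have \<epsilon>: "\<epsilon> > 0"
      using c B_less by (simp add: \<epsilon>_def)
    have "\<exists>K. K \<subseteq> \<Omega> \<and> compact K \<and> measure ?\<gamma> \<Omega> < measure ?\<gamma> K + \<epsilon>"
    proof (cases "measure ?\<gamma> \<Omega> = 0")
      case True
      then show ?thesis using \<epsilon> by (intro exI[of _ "{}"]) simp
    next
      case False
      then have "ennreal (measure ?\<gamma> \<Omega> - \<epsilon>) < emeasure ?\<gamma> \<Omega>"
        using \<epsilon> unfolding emeasure_eq_measure by (intro ennreal_lessI) (auto simp: zero_less_measure_iff)
      also have "emeasure ?\<gamma> \<Omega> = (SUP K\<in>{K. K \<subseteq> \<Omega> \<and> compact K}. emeasure ?\<gamma> K)"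
        using assms(2) by (intro inner_regular) (auto simp: emeasure_space_1)
      finally obtain K where "K \<subseteq> \<Omega>" "compact K" "ennreal (measure ?\<gamma> \<Omega> - \<epsilon>) < emeasure ?\<gamma> K"
        by (auto simp: less_SUP_iff)
      then show ?thesis
        using ennreal_leI[of "measure ?\<gamma> K" "measure ?\<gamma> \<Omega> - \<epsilon>"]
        by (intro exI[of _ K]) (auto simp: emeasure_eq_measure not_le[symmetric])
    qed
    then obtain K0 where K0: "K0 \<subseteq> \<Omega>" "compact K0" "measure ?\<gamma> \<Omega> < measure ?\<gamma> K0 + \<epsilon>"
      by blast
    \<comment> \<open>The approximating compact set may be empty when \<open>\<Omega>\<close> is a null set; a point of \<open>\<Omega>\<close> repairs this.\<close>
    define K where "K = insert w K0"
    have K: "K \<subseteq> \<Omega>" "compact K" "K \<noteq> {}"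
      using K0 w by (auto simp: K_def)
    have "measure ?\<gamma> K0 \<le> measure ?\<gamma> K"
      using borel_compact[OF K(2)] by (intro finite_measure_mono) (auto simp: K_def)
    with K0 have \<Omega>_less: "measure ?\<gamma> \<Omega> < measure ?\<gamma> K + \<epsilon>" by simp
    let ?L = "{k + s |k s. k \<in> K \<and> s \<in> ?S}"
    have "measure ?\<gamma> K + \<epsilon> \<le> measure ?\<gamma> ?L + measure ?\<gamma> ?B"
      unfolding \<epsilon>_def by (rule gaussian_compact_inequality[OF assms(1) K(2,3) c c_le]) simp
    moreover have "measure ?\<gamma> ?L \<le> measure (completion ?\<gamma>) ?D"
    proof -
      have "?L \<in> sets ?\<gamma>"
        using compact_sums[OF K(2) compact_sphere[of 0 R]] by (simp add: borel_compact)
      then have "measure ?\<gamma> ?L = measure (completion ?\<gamma>) ?L"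
        by simp
      also have "\<dots> \<le> measure (completion ?\<gamma>) ?D"
      proof (rule completion.finite_measure_mono)
        show "?L \<subseteq> ?D" using K(1) by blast
        show "?D \<in> sets (completion ?\<gamma>)"
          by (intro analytic_set_in_completion analytic_set_compact_sum analytic_set_borel assms
                finite_measure_axioms) auto
      qed
      finally show ?thesis .
    qed
    ultimately show ?thesis
      using \<Omega>_less unfolding compl by linarith
  qed
qed

end
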